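(* Let $\omega$ be a modulus of continuity for which there exist constants $C',C''$ such that for all $x>0$ $$\int_{0}^{x}\frac{\omega (t)}{t}\, dt \le C' \omega (x),\qquad x\int_{x}^{\infty}\frac{\omega (t)}{t^2}\, dt\le C'' \omega (x).$$ Let $L\subset\mathbb{R}^3$ be a bounded non-closed chord-arc curve and let $f$ be a complex-valued function on $L$. Suppose that there exist constants $C_1$ and $C_2$ such that for every $\delta>0$ there exists a function $\upsilon_\delta$ harmonic in $\Omega_\delta(L)$ with $$|\upsilon_\delta(M)-f(M)|\le C_1\,\omega(\delta)\quad\text{for all } M\in L,$$ $$|\nabla \upsilon_\delta(M)|\le C_2\,\frac{\omega(\delta)}{\delta}\quad\text{for all } M\in \Omega_{\delta}(L)\setminus\Omega_{\delta/2}(L).$$ Then $f\in H^{\omega}(L)$.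
   Context: A modulus of continuity is a continuous, nondecreasing, subadditive function $\omega:[0,\infty)\to[0,\infty)$ with $\omega(0)=0$ and $\omega(t)>0$ for $t>0$. A bounded non-closed Jordan curve $L\subset\mathbb{R}^3$ is a Jordan arc with two distinct endpoints, i.e. a homeomorphic image of $[0,1]$. It is a chord-arc curve if there is a constant $C=C(L)$ such that for all $M_1,M_2\in L$ the length of the subarc of $L$ between $M_1$ and $M_2$ does not exceed $C\|M_1M_2\|$, where $\|M_1M_2\|$ is the Euclidean distance in $\mathbb{R}^3$. $B_r(M)$ is the open ball in $\mathbb{R}^3$ with center $M$ and radius $r$, and $\Omega_\delta(L)=\bigcup_{M\in L}B_\delta(M)$. $H^\omega(L)$ is the space of all complex-valued functions $f$ on $L$ for which there is a constant $C_f$ with $|f(M_2)-f(M_1)|\le C_f\,\omega(\|M_1M_2\|)$ for all $M_1,M_2\in L$. Harmonic functions are complex-valued. *)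

theory Defs
  imports "HOL-Analysis.Analysis"
begin

(* Moduli are total functions on the reals; only their values on [0, oo) matter. *)
definition modulus_of_continuity :: "(real \<Rightarrow> real) \<Rightarrow> bool" where
  "modulus_of_continuity \<omega> \<longleftrightarrow>
     continuous_on {0..} \<omega> \<and>
     mono_on {0..} \<omega> \<and>
     (\<forall>s\<ge>0. \<forall>t\<ge>0. \<omega> (s + t) \<le> \<omega> s + \<omega> t) \<and>
     \<omega> 0 = 0 \<and>
     (\<forall>t>0. \<omega> t > 0)"

(* Possibly infinite length of g restricted to [a, b] (for a <= b), as the supremum of the
   lengths of inscribed polygons g (t 0), ..., g (t n). *)
definition curve_length :: "(real \<Rightarrow> 'a::metric_space) \<Rightarrow> real \<Rightarrow> real \<Rightarrow> ennreal" where
  "curve_length g a b =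
     Sup {\<Sum>i<n. ennreal (dist (g (t i)) (g (t (Suc i)))) | n t.
            t 0 = a \<and> t n = b \<and> (\<forall>i<n. t i \<le> t (Suc i))}"

(* The subarc of L between g s and g t is the image of [s, t] under g; it does not depend on
   the choice of the injective parametrization g, and neither does its length. *)
definition chord_arc_curve :: "'a::metric_space set \<Rightarrow> bool" where
  "chord_arc_curve L \<longleftrightarrow>
     (\<exists>g. arc g \<and> path_image g = L \<and>
       (\<exists>C. \<forall>s t. 0 \<le> s \<and> s \<le> t \<and> t \<le> 1 \<longrightarrow>
              curve_length g s t \<le> ennreal (C * dist (g s) (g t))))"

definition tube :: "real \<Rightarrow> 'a::metric_space set \<Rightarrow> 'a set" where
  "tube \<delta> L = (\<Union>M\<in>L. ball M \<delta>)"

definition partial_deriv ::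
  "'n::finite \<Rightarrow> (real^'n \<Rightarrow> 'b::real_normed_vector) \<Rightarrow> real^'n \<Rightarrow> 'b" where
  "partial_deriv i u x = frechet_derivative u (at x) (axis i 1)"

(* For complex-valued u, the norm of gradient u x is the square root of the sum of the squared
   moduli of the partial derivatives. *)
definition gradient ::
  "(real^'n::finite \<Rightarrow> 'b::real_normed_vector) \<Rightarrow> real^'n \<Rightarrow> 'b^'n" where
  "gradient u x = (\<chi> i. partial_deriv i u x)"

definition laplacian ::
  "(real^'n::finite \<Rightarrow> 'b::real_normed_vector) \<Rightarrow> real^'n \<Rightarrow> 'b" where
  "laplacian u x = (\<Sum>i\<in>UNIV. partial_deriv i (partial_deriv i u) x)"

definition C1_on ::
  "(real^'n::finite) set \<Rightarrow> (real^'n \<Rightarrow> 'b::real_normed_vector) \<Rightarrow> bool" where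
  "C1_on U u \<longleftrightarrow> (\<forall>x\<in>U. u differentiable (at x)) \<and> (\<forall>i. continuous_on U (partial_deriv i u))"

definition C2_on ::
  "(real^'n::finite) set \<Rightarrow> (real^'n \<Rightarrow> 'b::real_normed_vector) \<Rightarrow> bool" where
  "C2_on U u \<longleftrightarrow> C1_on U u \<and> (\<forall>i. C1_on U (partial_deriv i u))"

definition harmonic_on ::
  "(real^'n::finite) set \<Rightarrow> (real^'n \<Rightarrow> 'b::real_normed_vector) \<Rightarrow> bool" where
  "harmonic_on U u \<longleftrightarrow> open U \<and> C2_on U u \<and> (\<forall>x\<in>U. laplacian u x = 0)"

(* Functions on L are represented by total functions; membership depends only on their
   values on L. *)
definition H_space ::
  "(real \<Rightarrow> real) \<Rightarrow> 'a::metric_space set \<Rightarrow> ('a \<Rightarrow> complex) set" where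
  "H_space \<omega> L =
     {f. \<exists>C. \<forall>M1\<in>L. \<forall>M2\<in>L. cmod (f M2 - f M1) \<le> C * \<omega> (dist M1 M2)}"

end

(* Harmonicity is translation invariant, so the increment w x = v (x + h) - v x of a function
   harmonic in the delta-tube is harmonic in a slightly smaller tube. On the surface at distance
   3 delta / 4 from L the gradient hypothesis gives |w| <= const * |h| * omega delta / delta, and
   the maximum principle carries this bound inside, up to L. Taking h = M2 - M1 and
   delta = 16 |h| compares the values of v, hence those of f, at M1 and M2. Applying the maximum
   principle to increments instead of partial derivatives avoids interior regularity: v is only
   known to be twice continuously differentiable. *)

theory Submission
  imports Defs
begin

section \<open>A weak maximum principle on compact sets\<close>

text \<open>If \<open>b\<close> were positive, \<open>\<phi>'\<close>, which vanishes at the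
  maximum, would be positive just to the right of 0, and \<open>\<phi>\<close> would increase
  strictly there. The second derivative is used at the single point 0, so no continuity of it
  enters.\<close>

lemma second_derivative_nonpos_at_max:
  fixes \<phi> \<phi>' :: "real \<Rightarrow> real"
  assumes "e > 0"
    and d1: "\<And>t. \<bar>t\<bar> < e \<Longrightarrow> (\<phi> has_real_derivative \<phi>' t) (at t)"
    and d2: "(\<phi>' has_real_derivative b) (at 0)"
    and max: "\<And>t. \<bar>t\<bar> < e \<Longrightarrow> \<phi> t \<le> \<phi> 0"
  shows "b \<le> 0"
proof (rule ccontr)
  assume "\<not> b \<le> 0"
  have "\<phi>' 0 = 0"
    using DERIV_local_max[OF d1[of 0] \<open>e > 0\<close>] max \<open>e > 0\<close> by auto
  then obtain d where d: "d > 0" "\<And>h. 0 < h \<Longrightarrow> h < d \<Longrightarrow> \<phi>' h > 0"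
    using DERIV_pos_inc_right[OF d2] \<open>\<not> b \<le> 0\<close> by auto
  define h where "h = min d e / 2"
  have h: "0 < h" "h < d" "h < e" using \<open>e > 0\<close> d by (auto simp: h_def)
  have "\<phi> 0 < \<phi> h"
  proof (rule DERIV_pos_imp_increasing_open[OF h(1)])
    show "\<exists>y. (\<phi> has_real_derivative y) (at t) \<and> y > 0" if "0 < t" "t < h" for t
      using d1[of t] d(2)[of t] that h by auto
    show "continuous_on {0..h} \<phi>"
      using h by (intro DERIV_continuous_on[where D = \<phi>'] DERIV_subset[OF d1]) auto
  qed
  then show False using max[of h] h by auto
qed

text \<open>Along the line through \<open>x\<close> in direction \<open>i\<close>, the term
  \<open>\<epsilon> * (y \<bullet> y)\<close> is a quadratic polynomial that adds
  \<open>2 * \<epsilon>\<close> to the second derivative. Derivatives are taken along coordinate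
  lines, the form in which increments supply them later.\<close>

lemma line_second_derivative_nonpos_at_max:
  fixes u :: "real^'n \<Rightarrow> real"
  assumes "open U" "x \<in> U"
    and p: "\<And>y. y \<in> U \<Longrightarrow> ((\<lambda>t. u (y + t *\<^sub>R axis i 1)) has_real_derivative p y) (at 0)"
    and q: "((\<lambda>t. p (x + t *\<^sub>R axis i 1)) has_real_derivative q) (at 0)"
    and max: "\<And>y. y \<in> U \<Longrightarrow> u y + \<epsilon> * (y \<bullet> y) \<le> u x + \<epsilon> * (x \<bullet> x)"
  shows "q + 2 * \<epsilon> \<le> 0"
proof -
  obtain e where e: "e > 0" "ball x e \<subseteq> U"
    using assms(1,2) open_contains_ball by blast
  let ?y = "\<lambda>t. x + t *\<^sub>R axis i 1"
  have in_U: "?y t \<in> U" if "\<bar>t\<bar> < e" for t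
    using e that by (intro subsetD[OF e(2)]) (auto simp: dist_norm)
  have sq: "?y t \<bullet> ?y t = x \<bullet> x + 2 * t * (x $ i) + t\<^sup>2" for t
    by (simp add: inner_simps inner_axis inner_axis' inner_axis_axis power2_eq_square algebra_simps)
  show ?thesis
  proof (rule second_derivative_nonpos_at_max[OF e(1)])
    fix t assume t: "\<bar>t\<bar> < e"
    \<comment> \<open>The hypothesis differentiates at parameter 0 only; moving the base point to
      \<open>?y t\<close> and shifting the parameter gives the derivative at every
      \<open>t\<close>.\<close>
    have "((\<lambda>s. u (?y (s + t))) has_real_derivative p (?y t)) (at 0)"
      using p[OF in_U[OF t]] by (simp add: algebra_simps)
    then have "((\<lambda>s. u (?y s)) has_real_derivative p (?y t)) (at t)"
      using DERIV_shift[of "\<lambda>s. u (?y s)" "p (?y t)" 0 t] by simp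
    then show "((\<lambda>s. u (?y s) + \<epsilon> * (x \<bullet> x + 2 * s * (x $ i) + s\<^sup>2))
        has_real_derivative p (?y t) + \<epsilon> * (2 * (x $ i) + 2 * t)) (at t)"
      by (auto intro!: derivative_eq_intros)
    show "u (?y t) + \<epsilon> * (x \<bullet> x + 2 * t * (x $ i) + t\<^sup>2)
        \<le> u (?y 0) + \<epsilon> * (x \<bullet> x + 2 * 0 * (x $ i) + 0\<^sup>2)"
      using max[OF in_U[OF t]] unfolding sq by simp
  next
    show "((\<lambda>t. p (?y t) + \<epsilon> * (2 * (x $ i) + 2 * t)) has_real_derivative q + 2 * \<epsilon>) (at 0)"
      by (auto intro!: derivative_eq_intros q)
  qed
qed

text \<open>Adding \<open>\<epsilon> * (y \<bullet> y)\<close> makes the sum of the second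
  derivatives strictly positive, which rules out an interior maximum; then \<open>\<epsilon>\<close>
  tends to 0. As \<open>K\<close> is closed, \<open>K - interior K\<close> is its frontier.\<close>

lemma subharmonic_max_principle:
  fixes u :: "real^'n \<Rightarrow> real"
  assumes "compact K" and cont: "continuous_on K u"
    and p: "\<And>i y. y \<in> interior K \<Longrightarrow>
      ((\<lambda>t. u (y + t *\<^sub>R axis i 1)) has_real_derivative p i y) (at 0)"
    and q: "\<And>i y. y \<in> interior K \<Longrightarrow>
      ((\<lambda>t. p i (y + t *\<^sub>R axis i 1)) has_real_derivative q i y) (at 0)"
    and q_nonneg: "\<And>y. y \<in> interior K \<Longrightarrow> (\<Sum>i\<in>UNIV. q i y) \<ge> 0"
    and "x \<in> K"
  shows "\<exists>y \<in> K - interior K. u x \<le> u y"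
proof -
  have perturbed: "\<exists>y \<in> K - interior K. u x + \<epsilon> * (x \<bullet> x) \<le> u y + \<epsilon> * (y \<bullet> y)"
    if "\<epsilon> > 0" for \<epsilon>
  proof -
    have "continuous_on K (\<lambda>y. u y + \<epsilon> * (y \<bullet> y))"
      by (intro continuous_intros cont)
    then obtain y where y: "y \<in> K" "\<And>z. z \<in> K \<Longrightarrow> u z + \<epsilon> * (z \<bullet> z) \<le> u y + \<epsilon> * (y \<bullet> y)"
      using continuous_attains_sup[OF \<open>compact K\<close>] \<open>x \<in> K\<close> by blast
    have "y \<notin> interior K"
    proof
      assume yi: "y \<in> interior K"
      have "q i y \<le> - 2 * \<epsilon>" for i
        using line_second_derivative_nonpos_at_max
            [OF open_interior yi p q[OF yi, of i] y(2)[OF subsetD[OF interior_subset]]]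
        by (simp add: add.commute)
      then have "(\<Sum>i\<in>UNIV. q i y) \<le> (\<Sum>i\<in>(UNIV :: 'n set). - 2 * \<epsilon>)"
        by (rule sum_mono)
      also have "\<dots> < 0" using that by simp
      finally show False using q_nonneg[OF yi] by simp
    qed
    then show ?thesis using y \<open>x \<in> K\<close> by blast
  qed
  \<comment> \<open>The frontier point found above depends on \<open>\<epsilon>\<close>. A maximizer
    of \<open>u\<close> on the whole frontier is a fixed point that serves for all
    \<open>\<epsilon>\<close>.\<close>
  have "compact (K - interior K)"
    by (rule compact_diff[OF \<open>compact K\<close> open_interior])
  moreover have "K - interior K \<noteq> {}" using perturbed[OF zero_less_one] by blast
  moreover have "continuous_on (K - interior K) u"
    using cont by (rule continuous_on_subset) auto
  ultimately obtain y where y: "y \<in> K - interior K" "\<And>z. z \<in> K - interior K \<Longrightarrow> u z \<le> u y"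
    using continuous_attains_sup[of "K - interior K" u] by blast
  obtain R where R: "R > 0" "\<And>z. z \<in> K \<Longrightarrow> norm z \<le> R"
    using compact_imp_bounded[OF \<open>compact K\<close>] bounded_pos by blast
  have "u x \<le> u y"
  proof (rule field_le_epsilon)
    fix e :: real assume "e > 0"
    \<comment> \<open>With \<open>\<epsilon>\<close> equal to \<open>e / R\<^sup>2\<close>, the
      perturbation lies between 0 and \<open>e\<close> throughout \<open>K\<close>.\<close>
    then obtain z where z: "z \<in> K - interior K"
      "u x + e / R\<^sup>2 * (x \<bullet> x) \<le> u z + e / R\<^sup>2 * (z \<bullet> z)"
      using perturbed[of "e / R\<^sup>2"] R by auto
    have "z \<bullet> z \<le> R\<^sup>2"
      using R(2)[of z] z by (auto simp: power2_norm_eq_inner[symmetric] intro!: power_mono)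
    then have "e / R\<^sup>2 * (z \<bullet> z) \<le> e / R\<^sup>2 * R\<^sup>2"
      using \<open>e > 0\<close> by (intro mult_left_mono) auto
    moreover have "e / R\<^sup>2 * (x \<bullet> x) \<ge> 0" using \<open>e > 0\<close> by simp
    ultimately show "u x \<le> u y + e" using z y(2)[OF z(1)] R(1) by simp
  qed
  then show ?thesis using y by blast
qed

section \<open>The maximum principle for increments of harmonic functions\<close>

lemma has_vector_derivative_partial_deriv:
  assumes "u differentiable (at x)"
  shows "((\<lambda>t. u (x + t *\<^sub>R axis i 1)) has_vector_derivative partial_deriv i u x) (at 0)"
proof -
  have u: "(u has_derivative frechet_derivative u (at x)) (at (x + 0 *\<^sub>R axis i 1))"
    using assms by (simp add: frechet_derivative_works)
  have "((\<lambda>t. x + t *\<^sub>R axis i 1) has_derivative (\<lambda>t. t *\<^sub>R axis i 1)) (at 0)"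
    by (auto intro!: derivative_eq_intros)
  from has_derivative_compose[OF this u] show ?thesis
    using linear_scale[OF linear_frechet_derivative[OF assms]]
    by (simp add: has_vector_derivative_def partial_deriv_def)
qed

text \<open>Stated for general \<open>u\<close> because it is applied twice: to the harmonic
  function itself and to its partial derivatives.\<close>

lemma Re_mult_increment_has_real_derivative:
  fixes u :: "real^'n \<Rightarrow> complex"
  assumes "u differentiable (at (x + h))" "u differentiable (at x)"
  shows "((\<lambda>t. Re (c * (u ((x + t *\<^sub>R axis i 1) + h) - u (x + t *\<^sub>R axis i 1))))
    has_real_derivative Re (c * (partial_deriv i u (x + h) - partial_deriv i u x))) (at 0)"
proof -
  have "((\<lambda>t. u ((x + h) + t *\<^sub>R axis i 1) - u (x + t *\<^sub>R axis i 1))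
      has_vector_derivative partial_deriv i u (x + h) - partial_deriv i u x) (at 0)"
    by (intro has_vector_derivative_diff has_vector_derivative_partial_deriv assms)
  from bounded_linear.has_vector_derivative
      [OF bounded_linear_compose[OF bounded_linear_Re bounded_linear_mult_right[of c]] this]
  show ?thesis
    by (simp add: has_real_derivative_iff_has_vector_derivative o_def add_ac)
qed

text \<open>The maximum principle is for real functions, so the increment is multiplied by a
  constant \<open>c\<close> that turns its value at \<open>x\<close> into its modulus. The real part
  of the product has zero Laplacian in the interior of \<open>K\<close> and never exceeds the
  modulus of the increment.\<close>

lemma harmonic_increment_max_principle:
  fixes v :: "real^'n \<Rightarrow> complex"
  assumes "harmonic_on U v" "compact K" "K \<subseteq> U" and shift: "\<And>x. x \<in> K \<Longrightarrow> x + h \<in> U"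
    and B: "\<And>y. y \<in> K - interior K \<Longrightarrow> cmod (v (y + h) - v y) \<le> B"
    and "x \<in> K"
  shows "cmod (v (x + h) - v x) \<le> B"
proof -
  have v: "v differentiable (at y)" "partial_deriv i v differentiable (at y)"
    "(\<Sum>i\<in>UNIV. partial_deriv i (partial_deriv i v) y) = 0" if "y \<in> U" for y i
    using assms(1) that by (auto simp: harmonic_on_def C2_on_def C1_on_def laplacian_def)
  \<comment> \<open>If the increment at \<open>x\<close> vanishes, then \<open>c = 0\<close>; the
    argument needs only \<open>cmod c \<le> 1\<close>.\<close>
  define c where "c = cnj (sgn (v (x + h) - v x))"
  let ?u = "\<lambda>y. Re (c * (v (y + h) - v y))"
  have "\<exists>y \<in> K - interior K. ?u x \<le> ?u y"
  proof (rule subharmonic_max_principle[OF \<open>compact K\<close> _ _ _ _ \<open>x \<in> K\<close>])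
    have "continuous_on U v"
      by (intro continuous_at_imp_continuous_on ballI differentiable_imp_continuous_within v)
    then have "continuous_on K v" "continuous_on K (\<lambda>y. v (y + h))"
      using \<open>K \<subseteq> U\<close> shift
      by (auto intro: continuous_on_subset intro!: continuous_on_compose2[of U v] continuous_intros)
    then show "continuous_on K ?u" by (intro continuous_intros)
  next
    fix i y assume "y \<in> interior K"
    then have y: "y \<in> U" "y + h \<in> U" using interior_subset[of K] \<open>K \<subseteq> U\<close> shift by auto
    show "((\<lambda>t. ?u (y + t *\<^sub>R axis i 1)) has_real_derivative
        Re (c * (partial_deriv i v (y + h) - partial_deriv i v y))) (at 0)"
      by (intro Re_mult_increment_has_real_derivative v y)
    show "((\<lambda>t. Re (c * (partial_deriv i v ((y + t *\<^sub>R axis i 1) + h)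
          - partial_deriv i v (y + t *\<^sub>R axis i 1)))) has_real_derivative
        Re (c * (partial_deriv i (partial_deriv i v) (y + h)
          - partial_deriv i (partial_deriv i v) y))) (at 0)"
      by (intro Re_mult_increment_has_real_derivative v y)
  next
    fix y assume "y \<in> interior K"
    then have y: "y \<in> U" "y + h \<in> U" using interior_subset[of K] \<open>K \<subseteq> U\<close> shift by auto
    show "0 \<le> (\<Sum>i\<in>UNIV. Re (c * (partial_deriv i (partial_deriv i v) (y + h)
          - partial_deriv i (partial_deriv i v) y)))"
      unfolding Re_sum[symmetric] sum_distrib_left[symmetric] sum_subtractf v(3)[OF y(1)] v(3)[OF y(2)]
      by simp
  qed
  then obtain y where y: "y \<in> K - interior K" "?u x \<le> ?u y" by blast
  have "cnj (sgn z) * z = of_real (cmod z)" for z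
    using complex_norm_square[of z]
    by (cases "z = 0") (simp_all add: sgn_eq power2_eq_square mult.commute nonzero_divide_eq_eq)
  then have "c * (v (x + h) - v x) = of_real (cmod (v (x + h) - v x))"
    unfolding c_def .
  then have "cmod (v (x + h) - v x) = ?u x" by simp
  also have "\<dots> \<le> ?u y" by (fact y)
  also have "\<dots> \<le> cmod c * cmod (v (y + h) - v y)"
    by (metis complex_Re_le_cmod norm_mult)
  also have "\<dots> \<le> cmod (v (y + h) - v y)"
    by (rule mult_left_le_one_le) (auto simp: c_def norm_sgn)
  also have "\<dots> \<le> B" using y B by blast
  finally show ?thesis .
qed

section \<open>From the gradient bound on a shell to increments on the curve\<close>

text \<open>Expanding \<open>h\<close> in the standard basis and bounding each summand separately
  costs the factor \<open>CARD('n)\<close>; a constant depending on the dimension is harmless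
  here.\<close>

lemma norm_frechet_derivative_le_gradient:
  fixes u :: "real^'n \<Rightarrow> 'b::real_normed_vector"
  assumes "u differentiable (at x)"
  shows "norm (frechet_derivative u (at x) h) \<le> real CARD('n) * norm (gradient u x) * norm h"
proof -
  have lin: "linear (frechet_derivative u (at x))"
    by (rule linear_frechet_derivative[OF assms])
  have "(\<Sum>i\<in>UNIV. h $ i *\<^sub>R axis i 1) = h"
    using basis_expansion[of h] by (simp add: scalar_mult_eq_scaleR)
  then have "frechet_derivative u (at x) h = frechet_derivative u (at x) (\<Sum>i\<in>UNIV. h $ i *\<^sub>R axis i 1)"
    by simp
  also have "\<dots> = (\<Sum>i\<in>UNIV. h $ i *\<^sub>R partial_deriv i u x)"
    by (simp only: linear_sum[OF lin] linear_scale[OF lin] partial_deriv_def)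
  also have "norm \<dots> \<le> (\<Sum>i\<in>(UNIV::'n set). norm h * norm (gradient u x))"
  proof (rule sum_norm_le)
    fix i
    have "norm (partial_deriv i u x) \<le> norm (gradient u x)"
      using Finite_Cartesian_Product.norm_nth_le[of "gradient u x" i] by (simp add: gradient_def)
    then show "norm (h $ i *\<^sub>R partial_deriv i u x) \<le> norm h * norm (gradient u x)"
      using component_le_norm_cart[of h i] by (auto intro!: mult_mono)
  qed
  finally show ?thesis by (simp add: algebra_simps)
qed

lemma norm_increment_le_gradient_bound:
  fixes u :: "real^'n \<Rightarrow> 'b::real_normed_vector"
  assumes "\<And>y. y \<in> closed_segment x (x + h) \<Longrightarrow> u differentiable (at y) \<and> norm (gradient u y) \<le> G"
  shows "norm (u (x + h) - u x) \<le> real CARD('n) * G * norm h"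
proof -
  have "norm (u (x + h) - u x) \<le> real CARD('n) * G * norm ((x + h) - x)"
  proof (rule differentiable_bound[OF convex_closed_segment])
    fix y assume y: "y \<in> closed_segment x (x + h)"
    show "(u has_derivative frechet_derivative u (at y)) (at y within closed_segment x (x + h))"
      using assms[OF y] by (simp add: frechet_derivative_works has_derivative_at_withinI)
    have "norm (frechet_derivative u (at y) k) \<le> real CARD('n) * G * norm k" for k
      using assms[OF y]
      by (intro order_trans[OF norm_frechet_derivative_le_gradient] mult_right_mono mult_left_mono) auto
    then show "onorm (frechet_derivative u (at y)) \<le> real CARD('n) * G"
      by (intro onorm_le)
  qed auto
  then show ?thesis by simp
qed

text \<open>Makes tubes sublevel sets of a 1-Lipschitz function. The empty set is excluded because
  \<open>infdist x {}\<close> is 0 by convention while its tube is empty.\<close>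

lemma mem_tube_iff_infdist:
  assumes "L \<noteq> {}"
  shows "x \<in> tube \<delta> L \<longleftrightarrow> infdist x L < \<delta>"
proof
  assume "x \<in> tube \<delta> L"
  then obtain M where "M \<in> L" "dist x M < \<delta>" by (auto simp: tube_def dist_commute)
  then show "infdist x L < \<delta>" using infdist_le[of M L x] by linarith
next
  assume "infdist x L < \<delta>"
  then obtain M where "M \<in> L" "dist x M < \<delta>"
    using assms by (auto simp: infdist_def cINF_less_iff)
  then show "x \<in> tube \<delta> L" by (auto simp: tube_def dist_commute)
qed

lemma increment_le_gradient_on_shell:
  fixes v :: "real^'n \<Rightarrow> complex"
  assumes "compact L" "M \<in> L" "harmonic_on (tube \<delta> L) v" and h: "norm h < \<delta> / 8"
    and grad: "\<And>y. y \<in> tube \<delta> L - tube (\<delta> / 2) L \<Longrightarrow> norm (gradient v y) \<le> G"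
  shows "cmod (v (M + h) - v M) \<le> real CARD('n) * G * norm h"
proof -
  have "L \<noteq> {}" using \<open>M \<in> L\<close> by auto
  note tube = mem_tube_iff_infdist[OF this]
  have "\<delta> > 0" using h norm_ge_zero[of h] by linarith
  \<comment> \<open>The level \<open>3 * \<delta> / 4\<close> is the middle of the shell between
    \<open>\<delta> / 2\<close> and \<open>\<delta>\<close>. A shift by less than
    \<open>\<delta> / 8\<close> from that level stays between \<open>5 * \<delta> / 8\<close> and
    \<open>7 * \<delta> / 8\<close>, and \<open>K + h\<close> stays in the tube.\<close>
  define K where "K = {x. infdist x L \<le> 3 * \<delta> / 4}"
  have near: "\<bar>infdist y L - infdist x L\<bar> < \<delta> / 8" if "y \<in> closed_segment x (x + h)" for x y
    using infdist_triangle_abs[of y L x] dist_in_closed_segment[OF that] h by (auto simp: dist_commute dist_norm)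
  show ?thesis
  proof (rule harmonic_increment_max_principle[OF assms(3)])
    show "compact K"
      unfolding K_def using \<open>compact L\<close> \<open>L \<noteq> {}\<close> \<open>\<delta> > 0\<close> by (intro compact_infdist_le) auto
    show "K \<subseteq> tube \<delta> L" using \<open>\<delta> > 0\<close> by (auto simp: K_def tube)
    show "x + h \<in> tube \<delta> L" if "x \<in> K" for x
      using that near[OF ends_in_segment(2), of x] \<open>\<delta> > 0\<close>
      unfolding K_def tube mem_Collect_eq by linarith
    show "M \<in> K" using \<open>M \<in> L\<close> \<open>\<delta> > 0\<close> by (simp add: K_def)
  next
    fix x assume x: "x \<in> K - interior K"
    \<comment> \<open>Points strictly below the level are interior to \<open>K\<close>, so its
      frontier lies on the level itself.\<close>
    have "open {x. infdist x L < 3 * \<delta> / 4}"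
      by (intro open_Collect_less continuous_intros)
    then have "{x. infdist x L < 3 * \<delta> / 4} \<subseteq> interior K"
      by (intro interior_maximal) (auto simp: K_def)
    then have eq: "infdist x L = 3 * \<delta> / 4" using x by (force simp: K_def)
    show "cmod (v (x + h) - v x) \<le> real CARD('n) * G * norm h"
    proof (rule norm_increment_le_gradient_bound)
      fix y assume "y \<in> closed_segment x (x + h)"
      from near[OF this] have y: "y \<in> tube \<delta> L - tube (\<delta> / 2) L"
        using \<open>\<delta> > 0\<close> unfolding eq Diff_iff tube by linarith
      then have "v differentiable (at y)"
        using assms(3) by (auto simp: harmonic_on_def C2_on_def C1_on_def)
      then show "v differentiable (at y) \<and> norm (gradient v y) \<le> G" using grad[OF y] by simp
    qed
  qed
qed

section \<open>Comparison of the values of \<open>f\<close> at two points\<close>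

lemma modulus_of_continuity_mult_le:
  assumes "modulus_of_continuity \<omega>" "t \<ge> 0"
  shows "\<omega> (real n * t) \<le> real n * \<omega> t"
proof (induction n)
  case 0
  show ?case using assms by (simp add: modulus_of_continuity_def)
next
  case (Suc n)
  have "\<omega> (real n * t + t) \<le> \<omega> (real n * t) + \<omega> t"
    using assms by (simp add: modulus_of_continuity_def)
  with Suc show ?case by (simp add: algebra_simps)
qed

theorem mainTheorem2:
  fixes \<omega> :: "real \<Rightarrow> real" and L :: "(real^3) set" and f :: "real^3 \<Rightarrow> complex"
  assumes "modulus_of_continuity \<omega>"
    and "\<exists>C'. \<forall>x>0. set_integrable lborel {0<..x} (\<lambda>t. \<omega> t / t) \<and>
           (LBINT t:{0<..x}. \<omega> t / t) \<le> C' * \<omega> x"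
    and "\<exists>C''. \<forall>x>0. set_integrable lborel {x..} (\<lambda>t. \<omega> t / t\<^sup>2) \<and>
           x * (LBINT t:{x..}. \<omega> t / t\<^sup>2) \<le> C'' * \<omega> x"
    and "chord_arc_curve L"
    and "\<exists>C1 C2. \<forall>\<delta>>0. \<exists>v :: real^3 \<Rightarrow> complex.
           harmonic_on (tube \<delta> L) v \<and>
           (\<forall>M\<in>L. cmod (v M - f M) \<le> C1 * \<omega> \<delta>) \<and>
           (\<forall>M\<in>tube \<delta> L - tube (\<delta> / 2) L. norm (gradient v M) \<le> C2 * (\<omega> \<delta> / \<delta>))"
  shows "f \<in> H_space \<omega> L"
proof -
  from assms(5) obtain C1 C2 where approx: "\<And>\<delta>. \<delta> > 0 \<Longrightarrow> \<exists>v :: real^3 \<Rightarrow> complex.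
      harmonic_on (tube \<delta> L) v \<and>
      (\<forall>M\<in>L. cmod (v M - f M) \<le> C1 * \<omega> \<delta>) \<and>
      (\<forall>M\<in>tube \<delta> L - tube (\<delta> / 2) L. norm (gradient v M) \<le> C2 * (\<omega> \<delta> / \<delta>))"
    by blast
  have "compact L"
    using assms(4) compact_arc_image by (auto simp: chord_arc_curve_def)
  \<comment> \<open>The term in \<open>C1\<close> occurs once for each endpoint; the 3 is the
    dimension factor from the gradient estimate. Absolute values allow for constants of any
    sign.\<close>
  define A where "A = 2 * \<bar>C1\<bar> + 3 * \<bar>C2\<bar>"
  have "cmod (f M2 - f M1) \<le> 16 * A * \<omega> (dist M1 M2)" if M: "M1 \<in> L" "M2 \<in> L" for M1 M2
  proof (cases "M1 = M2")
    case True
    then show ?thesis using assms(1) by (simp add: modulus_of_continuity_def)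
  next
    case False
    define d where "d = dist M1 M2"
    have d: "d > 0" using False by (simp add: d_def)
    \<comment> \<open>Any fixed factor above 8 would give the strict inequality
      \<open>d < \<delta> / 8\<close>; an integer lets subadditivity turn
      \<open>\<omega> \<delta>\<close> back into a multiple of \<open>\<omega> d\<close>.\<close>
    define \<delta> where "\<delta> = 16 * d"
    have \<delta>: "\<delta> > 0" "d < \<delta> / 8" "d / \<delta> \<le> 1" using d by (auto simp: \<delta>_def)
    have \<omega>: "\<omega> \<delta> > 0" using assms(1) \<delta> by (simp add: modulus_of_continuity_def)
    obtain v where v: "harmonic_on (tube \<delta> L) v" "\<forall>M\<in>L. cmod (v M - f M) \<le> C1 * \<omega> \<delta>"
      "\<forall>M\<in>tube \<delta> L - tube (\<delta> / 2) L. norm (gradient v M) \<le> C2 * (\<omega> \<delta> / \<delta>)"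
      using approx[OF \<delta>(1)] by blast
    have "norm (M2 - M1) = d" by (simp add: d_def dist_norm norm_minus_commute)
    then have "cmod (v M2 - v M1) \<le> 3 * (C2 * (\<omega> \<delta> / \<delta>)) * d"
      using increment_le_gradient_on_shell[OF \<open>compact L\<close> M(1) v(1), of "M2 - M1" "C2 * (\<omega> \<delta> / \<delta>)"]
        v(3) \<delta> by simp
    \<comment> \<open>The step \<open>d\<close> cancels the \<open>\<delta>\<close> in the
      denominator of the gradient bound, leaving a multiple of
      \<open>\<omega> \<delta>\<close>.\<close>
    also have "\<dots> = 3 * C2 * \<omega> \<delta> * (d / \<delta>)" by simp
    also have "\<dots> \<le> 3 * \<bar>C2\<bar> * \<omega> \<delta> * (d / \<delta>)"
      using \<delta> d \<omega> by (intro mult_right_mono) auto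
    also have "\<dots> \<le> 3 * \<bar>C2\<bar> * \<omega> \<delta> * 1"
      using \<delta> \<omega> by (intro mult_left_mono) auto
    finally have "cmod (v M2 - v M1) \<le> 3 * \<bar>C2\<bar> * \<omega> \<delta>" by simp
    moreover have "cmod (v M - f M) \<le> \<bar>C1\<bar> * \<omega> \<delta>" if "M \<in> L" for M
      using v(2) that \<omega> by (auto intro: order_trans[OF _ mult_right_mono])
    moreover have "f M2 - f M1 = (v M2 - v M1) - (v M2 - f M2) + (v M1 - f M1)" by simp
    then have "cmod (f M2 - f M1) \<le> cmod (v M2 - v M1) + cmod (v M2 - f M2) + cmod (v M1 - f M1)"
      using norm_triangle_ineq norm_triangle_ineq4 by (smt (verit))
    ultimately have "cmod (f M2 - f M1) \<le> A * \<omega> \<delta>"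
      using M(1) M(2) by (smt (verit) A_def distrib_right mult.assoc)
    also have "\<dots> \<le> A * (16 * \<omega> d)"
      using modulus_of_continuity_mult_le[OF assms(1), of d 16] d
      by (intro mult_left_mono) (auto simp: \<delta>_def A_def)
    finally show ?thesis by (simp add: d_def)
  qed
  then show ?thesis unfolding H_space_def by blast
qed

end
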